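(* Let $S$ be a module over a commutative ring $R$ with unit $1=1_R$ and no zero divisors. For any element $k\in S$ and any invertible element $\alpha\in R$, the formulas $$a*b=\alpha a+k,\qquad a\,\sharp\, b=\alpha^{-1}a-\alpha^{-1}k\qquad(a,b\in S)$$ define a flat biquandle structure on $S$, and these formulas give the general affine linear flat biquandle with coefficients in $R$. That is, whenever $r,s,p,q\in R$ and $k,l\in S$ are such that $$a*b=ra+sb+k,\qquad a\,\sharp\, b=pa+qb+l$$ define a flat biquandle structure on $S$, there exist an invertible $\alpha\in R$ and an element $k'\in S$ such that $a*b=\alpha a+k'$ and $a\,\sharp\, b=\alpha^{-1}a-\alpha^{-1}k'$ for all $a,b\in S$.
   Context: A flat biquandle is a set $S$ with two binary operations $a*b$ and $a\,\sharp\, b$ satisfying the following axioms. (1) For each $a\in S$ there is a unique $x\in S$ such that $a\,\sharp\, x=x$ and $x*a=a$. For each $a\in S$ there is a unique $y\in S$ such that $a*y=y$ and $y\,\sharp\, a=a$. (2) For all $a,b\in S$, $(a\,\sharp\, b)*(b*a)=a$ and $(b*a)\,\sharp\,(a\,\sharp\, b)=b$. For all $a,b\in S$ there exist unique elements $x,y\in S$ such that $x=b\,\sharp\, y$, $y=a\,\sharp\, x$, $b=x*a$ and $a=y*b$. (3) For all $a,b,c\in S$, $$(a\,\sharp\, b)\,\sharp\, c=(a\,\sharp\,(c*b))\,\sharp\,(b\,\sharp\, c),$$ $$(c*b)*a=(c*(a\,\sharp\, b))*(b*a),$$ $$(b\,\sharp\, c)*(a\,\sharp\,(c*b))=(b*a)\,\sharp\,(c*(a\,\sharp\,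 b)).$$ An affine (linear) flat biquandle with coefficients in $R$ is a flat biquandle whose underlying set $S$ is a module over the commutative ring $R$ and whose operations have the form $a*b=ra+sb+k$, $a\,\sharp\, b=pa+qb+l$ with $r,s,p,q\in R$ and $k,l\in S$.
   Formalization: The converse (that these formulas are the general ones) is proved only for S faithful over R (only 0 acts as zero) or S = 0; without this it fails: over the integers, a*b=2a, a♯b=3a is a flat biquandle on Z/5, but 2 acts as neither 1 nor -1. *)

theory Defs
  imports Complex_Main
begin

definition flat_biquandle ::
    "'a set \<Rightarrow> ('a \<Rightarrow> 'a \<Rightarrow> 'a) \<Rightarrow> ('a \<Rightarrow> 'a \<Rightarrow> 'a) \<Rightarrow> bool" where
  "flat_biquandle S star sharp \<longleftrightarrow>
     (\<forall>a\<in>S. \<forall>b\<in>S. star a b \<in> S \<and> sharp a b \<in> S) \<and>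
     (\<forall>a\<in>S. \<exists>!x. x \<in> S \<and> sharp a x = x \<and> star x a = a) \<and>
     (\<forall>a\<in>S. \<exists>!y. y \<in> S \<and> star a y = y \<and> sharp y a = a) \<and>
     (\<forall>a\<in>S. \<forall>b\<in>S. star (sharp a b) (star b a) = a \<and> sharp (star b a) (sharp a b) = b) \<and>
     (\<forall>a\<in>S. \<forall>b\<in>S. \<exists>!p. p \<in> S \<times> S \<and>
        (case p of (x, y) \<Rightarrow>
           x = sharp b y \<and> y = sharp a x \<and> b = star x a \<and> a = star y b)) \<and>
     (\<forall>a\<in>S. \<forall>b\<in>S. \<forall>c\<in>S.
        sharp (sharp a b) c = sharp (sharp a (star c b)) (sharp b c) \<and>
        star (star c b) a = star (star c (sharp a b)) (star b a) \<and>
        star (sharp b c) (sharp a (star c b)) = sharp (star b a) (star c (sharp a b)))"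

text \<open>
  Recovering the coefficients of an affine operation from the operation itself requires that
  distinct scalars act differently. Every nonzero torsion-free module has this property. Without
  it the classification fails: over the integers, \<open>a * b = 2 a\<close> and \<open>a \<sharp> b = 3 a\<close> form a flat
  biquandle on \<open>\<int>/5\<close>, but \<open>2\<close> acts on \<open>\<int>/5\<close> as neither of the invertible integers.
\<close>

definition faithful_module :: "('r::comm_ring_1 \<Rightarrow> 's::ab_group_add \<Rightarrow> 's) \<Rightarrow> bool" where
  "faithful_module scale \<longleftrightarrow> module scale \<and> (\<forall>r. (\<forall>x. scale r x = 0) \<longrightarrow> r = 0)"

end

theory Submission
  imports Defs
begin

text \<open>
  Comparing coefficients, the second axiom gives \<open>r p + s\<^sup>2 = 1 = p r + q\<^sup>2\<close>, and the third gives
  \<open>q = p q r + q\<^sup>2\<close>, hence \<open>q\<^sup>2 = q\<^sup>3\<close> and \<open>q \<in> {0, 1}\<close>. If \<open>q = 0\<close>, then \<open>p\<close> is invertible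
  with inverse \<open>r\<close> and \<open>p (s + q) = 0\<close> forces \<open>s = 0\<close>. If \<open>q = 1\<close>, then \<open>s \<noteq> 0\<close> and
  \<open>p q s = r s q = 0\<close> leave \<open>a * b = b + k\<close> and \<open>a \<sharp> b = b + l\<close>, and the first axiom then makes
  every \<open>x\<close> a solution of an equation with a unique solution, so the module is trivial.
\<close>

text \<open>At \<open>a = b = c = 0\<close> only the constants survive. With all but one variable
  set to \<open>0\<close>, two scalars act alike, so their difference annihilates the module and
  vanishes by faithfulness.\<close>

lemma (in module) faithful_affine_eqD:
  assumes faithful: "faithful_module scale"
    and eq: "\<And>a b c. scale u a + scale v b + scale w c + m = scale u' a + scale v' b + scale w' c + m'"
  shows "u = u' \<and> v = v' \<and> w = w' \<and> m = m'"
proof -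
  have m: "m = m'"
    using eq[of 0 0 0] by simp
  have scalar_eq: "t = t'" if "\<And>x. scale t x = scale t' x" for t t'
  proof -
    have "\<forall>x. scale (t - t') x = 0"
      using that by (simp add: scale_left_diff_distrib)
    then have "t - t' = 0"
      using faithful unfolding faithful_module_def by blast
    then show ?thesis by simp
  qed
  have "u = u'"
    by (rule scalar_eq) (use eq[of _ 0 0] m in simp)
  moreover have "v = v'"
    by (rule scalar_eq) (use eq[of 0 _ 0] m in simp)
  moreover have "w = w'"
    by (rule scalar_eq) (use eq[of 0 0] m in simp)
  ultimately show ?thesis
    using m by simp
qed

text \<open>As neither operation depends on its second argument, every solution demanded by an axiom
  is forced to be a value of \<open>f\<close> or \<open>g\<close>, and the exchange laws reduce to
  cancelling \<open>f\<close> against \<open>g\<close>.\<close>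

lemma flat_biquandle_inverse_maps:
  assumes "\<And>x. f (g x) = x" "\<And>x. g (f x) = x"
  shows "flat_biquandle UNIV (\<lambda>a b. f a) (\<lambda>a b. g a)"
  unfolding flat_biquandle_def by (auto simp: assms)

lemma (in module) flat_biquandle_affine:
  assumes "\<alpha> * \<beta> = 1"
  shows "flat_biquandle UNIV (\<lambda>a b. scale \<alpha> a + k) (\<lambda>a b. scale \<beta> a - scale \<beta> k)"
proof (rule flat_biquandle_inverse_maps)
  have "\<beta> * \<alpha> = 1"
    using assms by (simp add: mult.commute)
  then show "scale \<beta> (scale \<alpha> x + k) - scale \<beta> k = x" for x
    by (simp add: scale_right_distrib)
  show "scale \<alpha> (scale \<beta> x - scale \<beta> k) + k = x" for x
    using assms by (simp add: scale_right_diff_distrib)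
qed

lemma flat_biquandle_affine_coeffs:
  fixes scale :: "'r::idom \<Rightarrow> 's::ab_group_add \<Rightarrow> 's"
  assumes faithful: "faithful_module scale"
    and fb: "flat_biquandle UNIV
      (\<lambda>a b. scale r a + scale s b + k)
      (\<lambda>a b. scale p a + scale q b + l)"
  shows "s = 0 \<and> q = 0 \<and> r * p = 1 \<and> l = - scale p k"
proof -
  interpret module scale
    using faithful by (simp add: faithful_module_def)
  let ?star = "\<lambda>a b. scale r a + scale s b + k"
  let ?sharp = "\<lambda>a b. scale p a + scale q b + l"
  have ax1: "\<exists>!x. ?sharp a x = x \<and> ?star x a = a" for a
    using fb by (simp add: flat_biquandle_def)
  have ax2: "?star (?sharp a b) (?star b a) = a" "?sharp (?star b a) (?sharp a b) = b" for a b
    using fb by (simp_all add: flat_biquandle_def)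
  have ax3: "?sharp (?sharp a b) c = ?sharp (?sharp a (?star c b)) (?sharp b c)"
    "?star (?star c b) a = ?star (?star c (?sharp a b)) (?star b a)" for a b c
    using fb unfolding flat_biquandle_def by blast+

  \<comment> \<open>The identity involves only \<open>a\<close> and \<open>b\<close>;
    \<open>(0::'r) = 0\<close> fills the slot of the third coefficient.\<close>
  have "r * p + s * s = 1 \<and> r * q + s * r = 0 \<and> (0::'r) = 0 \<and> scale r l + scale s k + k = 0"
    by (rule faithful_affine_eqD[OF faithful]) (use ax2(1) in \<open>simp add: algebra_simps\<close>)
  then have rp: "r * p + s * s = 1" by blast
  have "p * s + q * p = 0 \<and> p * r + q * q = 1 \<and> (0::'r) = 0 \<and> scale p k + scale q l + l = 0"
    by (rule faithful_affine_eqD[OF faithful]) (use ax2(2) in \<open>simp add: algebra_simps\<close>)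
  then have ps: "p * s + q * p = 0" and pr: "p * r + q * q = 1"
    and l: "scale p k + scale q l + l = 0" by blast+
  \<comment> \<open>The coefficient of \<open>b\<close> yields \<open>p * q * s = 0\<close>, that of
    \<open>c\<close> the equation for \<open>q\<close>.\<close>
  have "p * p = p * p \<and> p * q = p * q * s + q * p \<and> q = p * q * r + q * q \<and>
      scale p l + l = scale p (scale q k + l) + scale q l + l"
    by (rule faithful_affine_eqD[OF faithful]) (use ax3(1) in \<open>simp add: algebra_simps\<close>)
  then have pqs: "p * q * s = 0" and q: "q = p * q * r + q * q" by (simp_all add: mult.commute)
  have "s = r * s * p + s * s \<and> r * s = r * s * q + s * r \<and> r * r = r * r \<and>
      scale r k + k = scale r (scale s l + k) + scale s k + k"
    by (rule faithful_affine_eqD[OF faithful]) (use ax3(2) in \<open>simp add: algebra_simps\<close>)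
  then have rsq: "r * s * q = 0" by (simp add: mult.commute)

  \<comment> \<open>Substitute \<open>p * r = 1 - q * q\<close> into the equation for
    \<open>q\<close>.\<close>
  have "q * q * (q - 1) = 0"
    using pr q by algebra
  then consider "q = 0" | "q = 1" by auto
  then show ?thesis
  proof cases
    case 1
    then have "p * r = 1" using pr by simp
    then have "s = 0" using ps 1 by auto
    moreover have "l = - scale p k"
      using l 1 by (simp add: eq_neg_iff_add_eq_0 add.commute)
    ultimately show ?thesis using 1 \<open>p * r = 1\<close> by (simp add: mult.commute)
  next
    case 2
    \<comment> \<open>Here \<open>p * r = 0\<close>, so \<open>s * s = 1\<close>.\<close>
    then have "s \<noteq> 0" using pr rp by (auto simp: mult.commute)
    then have "p = 0" "r = 0" using 2 pqs rsq by auto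
    have "x = 0" for x :: 's
    proof -
      obtain z where "?sharp 0 z = z \<and> ?star z 0 = 0"
        using ax1[of 0] by blast
      \<comment> \<open>The equations at \<open>z\<close> now read \<open>z + l = z\<close> and
        \<open>k = 0\<close>; they do not depend on \<open>z\<close>, so every \<open>y\<close>
        solves them.\<close>
      then have "?sharp 0 y = y \<and> ?star y 0 = 0" for y
        using 2 \<open>p = 0\<close> \<open>r = 0\<close> by simp
      then show ?thesis
        using ax1[of 0] by blast
    qed
    \<comment> \<open>On a trivial module \<open>1\<close> acts as zero, so faithfulness contradicts
      \<open>1 \<noteq> 0\<close>.\<close>
    then have "(1::'r) = 0"
      using faithful unfolding faithful_module_def by blast
    then show ?thesis by simp
  qed
qed

theorem mainTheorem3:
  fixes scale :: "'r::idom \<Rightarrow> 's::ab_group_add \<Rightarrow> 's"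
  assumes "module scale"
  shows "(\<forall>\<alpha> \<alpha>inv k. \<alpha> * \<alpha>inv = 1 \<longrightarrow>
            flat_biquandle UNIV
              (\<lambda>a b. scale \<alpha> a + k)
              (\<lambda>a b. scale \<alpha>inv a - scale \<alpha>inv k)) \<and>
         (faithful_module scale \<or> (\<forall>x::'s. x = 0) \<longrightarrow>
           (\<forall>r s p q k l.
              flat_biquandle UNIV
                (\<lambda>a b. scale r a + scale s b + k)
                (\<lambda>a b. scale p a + scale q b + l) \<longrightarrow>
              (\<exists>\<alpha> \<alpha>inv k'. \<alpha> * \<alpha>inv = 1 \<and>
                 (\<forall>a b. scale r a + scale s b + k = scale \<alpha> a + k' \<and>
                        scale p a + scale q b + l = scale \<alpha>inv a - scale \<alpha>inv k'))))"
proof -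
  interpret module scale by fact
  show ?thesis
  proof (intro conjI allI impI)
    fix \<alpha> \<alpha>inv :: 'r and k :: 's
    assume "\<alpha> * \<alpha>inv = 1"
    then show "flat_biquandle UNIV (\<lambda>a b. scale \<alpha> a + k) (\<lambda>a b. scale \<alpha>inv a - scale \<alpha>inv k)"
      by (rule flat_biquandle_affine)
  next
    fix r s p q :: 'r and k l :: 's
    assume cases: "faithful_module scale \<or> (\<forall>x::'s. x = 0)"
      and fb: "flat_biquandle UNIV
        (\<lambda>a b. scale r a + scale s b + k) (\<lambda>a b. scale p a + scale q b + l)"
    show "\<exists>\<alpha> \<alpha>inv k'. \<alpha> * \<alpha>inv = 1 \<and>
        (\<forall>a b. scale r a + scale s b + k = scale \<alpha> a + k' \<and>
               scale p a + scale q b + l = scale \<alpha>inv a - scale \<alpha>inv k')"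
      using cases
    proof
      assume "faithful_module scale"
      then have "s = 0 \<and> q = 0 \<and> r * p = 1 \<and> l = - scale p k"
        using fb by (rule flat_biquandle_affine_coeffs)
      then show ?thesis
        by (intro exI[of _ r] exI[of _ p] exI[of _ k]) simp
    next
      assume "\<forall>x::'s. x = 0"
      then have trivial: "x = y" for x y :: 's by metis
      \<comment> \<open>In a trivial module \<open>r\<close> need not be invertible, so
        \<open>1\<close> is taken as the scalar instead; all equations in the module hold.\<close>
      have "(1::'r) * 1 = 1 \<and>
          (\<forall>a b. scale r a + scale s b + k = scale 1 a + 0 \<and>
                 scale p a + scale q b + l = scale 1 a - scale 1 0)"
        by (intro conjI allI trivial mult_1)
      then show ?thesis by blast
    qed
  qed
qed

end
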